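(* For each regular curve $c\in\operatorname{Imm}(S^1,\mathbb R^2)$ the tangent space can be decomposed as $$T_c\operatorname{Imm}(S^1,\mathbb R^2)=\operatorname{Tan}(c)\oplus\operatorname{Arc}^0(c),$$ where $$\operatorname{Tan}(c):=\{h=f\,v:\ f\in C^\infty(S^1)\},$$ $$\operatorname{Arc}^0(c):=\{h=a\,n+b\,v:\ a,b\in C^\infty(S^1),\ D_s^2b=D_s(a\kappa)\text{ and }b(0)=0\}.$$ The corresponding projections onto these subspaces are given, for $k\in T_c\operatorname{Imm}(S^1,\mathbb R^2)$, by $$P^{\operatorname{Arc}^0}(k)=\langle k,n\rangle\,n+b\,v,\qquad P^{\operatorname{Tan}}(k)=\langle k,v\rangle\,v-b\,v,$$ where $b\in C^\infty(S^1)$ solves $$D_s^2b=D_s(\langle k,n\rangle\kappa)\quad\text{with } b(0)=0.$$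
   Context: $\operatorname{Imm}(S^1,\mathbb R^2)$ is the space of regular planar curves, i.e. smooth maps $c:S^1\to\mathbb R^2$ with $c'(\theta)\neq 0$ for all $\theta$; it is open in $C^\infty(S^1,\mathbb R^2)$, so $T_c\operatorname{Imm}(S^1,\mathbb R^2)=C^\infty(S^1,\mathbb R^2)$. $C^\infty(S^1)$ denotes smooth real-valued functions on $S^1$, and $0\in S^1=\mathbb R/2\pi\mathbb Z$ is the base point. For a curve $c$: $D_s=\frac{1}{|c'|}\partial_\theta$ is differentiation with respect to arc length, $v=c'/|c'|$ is the unit tangent field, $n=iv$ is the unit normal field ($i$ being rotation by $\pi/2$ in $\mathbb R^2\cong\mathbb C$), and $\kappa$ is the curvature, determined by $D_sv=\kappa n$ (equivalently $D_sn=-\kappa v$). *)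

theory Defs
  imports "HOL-Analysis.Analysis" "HOL-Library.Function_Algebras"
begin

instantiation "fun" :: (type, real_vector) real_vector
begin

definition scaleR_fun :: "real \<Rightarrow> ('a \<Rightarrow> 'b) \<Rightarrow> 'a \<Rightarrow> 'b" where
  "scaleR_fun r f = (\<lambda>x. r *\<^sub>R f x)"

instance
  by standard (simp_all add: scaleR_fun_def fun_eq_iff scaleR_add_right scaleR_add_left)

end

definition direct_sum_decomp :: "'a::real_vector set \<Rightarrow> 'a set \<Rightarrow> 'a set \<Rightarrow> bool" where
  "direct_sum_decomp W U V \<longleftrightarrow>
     subspace U \<and> subspace V \<and> W = {u + w | u w. u \<in> U \<and> w \<in> V} \<and> U \<inter> V = {0}"

text \<open>The projection of \<open>U \<oplus> V\<close> onto \<open>U\<close> along \<open>V\<close>; only meaningful on \<open>U \<oplus> V\<close>.\<close>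

definition proj_along :: "'a::real_vector set \<Rightarrow> 'a set \<Rightarrow> 'a \<Rightarrow> 'a" where
  "proj_along U V k = (THE u. u \<in> U \<and> (\<exists>w\<in>V. k = u + w))"

text \<open>Functions on the circle \<open>\<real> / 2\<pi>\<int>\<close> are represented by their \<open>2\<pi>\<close>-periodic lifts to
  \<open>\<real>\<close>, and the plane is identified with the complex numbers.\<close>

definition smooth :: "(real \<Rightarrow> 'a::real_normed_vector) \<Rightarrow> bool" where
  "smooth f \<longleftrightarrow>
     (\<forall>m x. ((\<lambda>g t. vector_derivative g (at t)) ^^ m) f differentiable (at x))"

definition smooth_S1 :: "(real \<Rightarrow> 'a::real_normed_vector) set" where
  "smooth_S1 = {f. smooth f \<and> (\<forall>\<theta>. f (\<theta> + 2 * pi) = f \<theta>)}"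

definition Imm :: "(real \<Rightarrow> complex) set" where
  "Imm = {c \<in> smooth_S1. \<forall>\<theta>. vector_derivative c (at \<theta>) \<noteq> 0}"

text \<open>The space of immersions is open in the vector space of all smooth maps from the circle to
  the plane, so its tangent space at every point is that whole vector space.\<close>

definition T_Imm :: "(real \<Rightarrow> complex) \<Rightarrow> (real \<Rightarrow> complex) set" where
  "T_Imm c = smooth_S1"

definition D_s :: "(real \<Rightarrow> complex) \<Rightarrow> (real \<Rightarrow> 'a::real_normed_vector) \<Rightarrow> real \<Rightarrow> 'a" where
  "D_s c f = (\<lambda>\<theta>. (1 / norm (vector_derivative c (at \<theta>))) *\<^sub>R vector_derivative f (at \<theta>))"

definition unit_tangent :: "(real \<Rightarrow> complex) \<Rightarrow> real \<Rightarrow> complex" where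
  "unit_tangent c = (\<lambda>\<theta>. vector_derivative c (at \<theta>) /\<^sub>R norm (vector_derivative c (at \<theta>)))"

definition unit_normal :: "(real \<Rightarrow> complex) \<Rightarrow> real \<Rightarrow> complex" where
  "unit_normal c = (\<lambda>\<theta>. \<i> * unit_tangent c \<theta>)"

text \<open>For an immersion the value below exists, because the unit tangent has constant length and so
  its derivative is normal to it, and it is unique, because the unit normal does not vanish.\<close>

definition curvature :: "(real \<Rightarrow> complex) \<Rightarrow> real \<Rightarrow> real" where
  "curvature c \<theta> = (THE k. D_s c (unit_tangent c) \<theta> = k *\<^sub>R unit_normal c \<theta>)"

definition arc_equation ::
    "(real \<Rightarrow> complex) \<Rightarrow> (real \<Rightarrow> real) \<Rightarrow> (real \<Rightarrow> real) \<Rightarrow> bool" where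
  "arc_equation c a b \<longleftrightarrow>
     D_s c (D_s c b) = D_s c (\<lambda>\<theta>. a \<theta> * curvature c \<theta>) \<and> b 0 = 0"

definition Tan :: "(real \<Rightarrow> complex) \<Rightarrow> (real \<Rightarrow> complex) set" where
  "Tan c = {(\<lambda>\<theta>. f \<theta> *\<^sub>R unit_tangent c \<theta>) | f. f \<in> smooth_S1}"

definition Arc0 :: "(real \<Rightarrow> complex) \<Rightarrow> (real \<Rightarrow> complex) set" where
  "Arc0 c = {(\<lambda>\<theta>. a \<theta> *\<^sub>R unit_normal c \<theta> + b \<theta> *\<^sub>R unit_tangent c \<theta>) | a b.
     a \<in> smooth_S1 \<and> b \<in> smooth_S1 \<and> arc_equation c a b}"

end

theory Submission
  imports Defs
begin

text \<open>
  In the moving frame a vector field along \<open>c\<close> is \<open>k = \<langle>k, n\<rangle> n + \<langle>k, v\<rangle> v\<close>. Subtracting a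
  tangential field changes only the second coefficient, so the decomposition amounts to the claim
  that every normal coefficient \<open>a\<close> has exactly one tangential companion \<open>b\<close> with
  \<open>D\<^sub>s\<^sup>2 b = D\<^sub>s (a \<kappa>)\<close> and \<open>b 0 = 0\<close>. Then \<open>k\<close> is the sum of \<open>\<langle>k, n\<rangle> n + b v\<close> and
  \<open>(\<langle>k, v\<rangle> - b) v\<close>.

  The equation can be integrated once: since \<open>\<bar>c'\<bar> D\<^sub>s\<close> is the ordinary derivative, it says that
  \<open>D\<^sub>s b - a \<kappa>\<close> is a constant \<open>C\<close>, that is, \<open>b' = \<bar>c'\<bar> (a \<kappa> + C)\<close>
  (\<open>arc_equation_iff_first_integral\<close>). On the line, this and \<open>b 0 = 0\<close> determine \<open>b\<close> for each
  \<open>C\<close>; on the circle, \<open>b\<close> must also return to its initial value, i.e. \<open>C\<close> times the length of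
  \<open>c\<close> must cancel the integral of \<open>a \<kappa>\<close> over \<open>c\<close>. As the length is positive there is such a
  \<open>C\<close> (\<open>arc_equation_exists\<close>) and no other (\<open>arc_equation_homogeneous_unique\<close>,
  \<open>arc_equation_unique\<close>).

  Smoothness needs a calculus of smooth functions. The products by which the frame, the curvature
  and \<open>D\<^sub>s\<close> are built are bilinear, and \<open>1 / \<bar>c'\<bar>\<close> is a real power of the positive function
  \<open>\<langle>c', c'\<rangle>\<close>. It therefore suffices to treat sums, bilinear products and powers, besides
  primitives for the solutions \<open>b\<close>.
\<close>

section \<open>Calculus of smooth functions of a real variable\<close>

text \<open>Smoothness refers to all iterated derivatives at once; counting derivatives makes closure
  properties accessible to induction. The recursion takes the derivative inside, so that an induction
  step differentiates \<open>f\<close> once and leaves the rest to the hypothesis for \<open>f'\<close>.\<close>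
primrec times_differentiable :: "nat \<Rightarrow> (real \<Rightarrow> 'a::real_normed_vector) \<Rightarrow> bool" where
  "times_differentiable 0 f \<longleftrightarrow> True"
| "times_differentiable (Suc m) f \<longleftrightarrow>
     (\<forall>x. f differentiable (at x)) \<and> times_differentiable m (\<lambda>t. vector_derivative f (at t))"

lemma times_differentiable_iff_iterates:
  "times_differentiable m f \<longleftrightarrow>
     (\<forall>j<m. \<forall>x. ((\<lambda>g t. vector_derivative g (at t)) ^^ j) f differentiable (at x))"
proof (induction m arbitrary: f)
  case (Suc m)
  show ?case
    by (auto simp: Suc less_Suc_eq_0_disj funpow_Suc_right simp del: funpow.simps(2))
qed simp

lemma smooth_iff_times_differentiable: "smooth f \<longleftrightarrow> (\<forall>m. times_differentiable m f)"
  unfolding smooth_def times_differentiable_iff_iterates by blast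

text \<open>The pattern of the closure proofs below: once a formula for the derivative is known, only the
  formula has to be examined, one order lower.\<close>
lemma times_differentiable_Suc_iff:
  assumes "\<And>x. (f has_vector_derivative f' x) (at x)"
  shows "times_differentiable (Suc m) f \<longleftrightarrow> times_differentiable m f'"
proof -
  have "(\<lambda>t. vector_derivative f (at t)) = f'"
    using assms vector_derivative_at by blast
  moreover have "\<forall>x. f differentiable (at x)"
    using assms differentiableI_vector by blast
  ultimately show ?thesis by simp
qed

lemma times_differentiable_Suc_has_vector_derivative:
  "times_differentiable (Suc m) f \<Longrightarrow> (f has_vector_derivative vector_derivative f (at x)) (at x)"
  by (simp add: vector_derivative_works)

lemma times_differentiable_lower: "times_differentiable (Suc m) f \<Longrightarrow> times_differentiable m f"
proof (induction m arbitrary: f)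
  case (Suc m)
  have "times_differentiable m (\<lambda>t. vector_derivative f (at t))"
    using Suc.prems by (intro Suc.IH) (simp)
  with Suc.prems show ?case by simp
qed simp

lemma times_differentiable_const: "times_differentiable m (\<lambda>x. k)"
proof (induction m arbitrary: k)
  case (Suc m)
  then show ?case
    using times_differentiable_Suc_iff[of "\<lambda>x. k" "\<lambda>x. 0"] by auto
qed simp

lemma times_differentiable_add:
  assumes "times_differentiable m f" "times_differentiable m g"
  shows "times_differentiable m (\<lambda>x. f x + g x)"
  using assms
proof (induction m arbitrary: f g)
  case (Suc m)
  have "((\<lambda>x. f x + g x) has_vector_derivative
          vector_derivative f (at x) + vector_derivative g (at x)) (at x)" for x
    using Suc.prems[THEN times_differentiable_Suc_has_vector_derivative]
    by (intro has_vector_derivative_add)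
  moreover have "times_differentiable m (\<lambda>x. vector_derivative f (at x) + vector_derivative g (at x))"
    using Suc.prems by (intro Suc.IH) simp_all
  ultimately show ?case
    by (rule times_differentiable_Suc_iff[THEN iffD2])
qed simp

text \<open>The derivative of a product is a sum of two products of functions with one order left. Stated
  for bilinear maps, this serves multiplication, scaling and the inner product alike.\<close>
lemma (in bounded_bilinear) times_differentiable:
  assumes "times_differentiable m f" "times_differentiable m g"
  shows "times_differentiable m (\<lambda>x. prod (f x) (g x))"
  using assms
proof (induction m arbitrary: f g)
  case (Suc m)
  let ?f' = "\<lambda>x. vector_derivative f (at x)" and ?g' = "\<lambda>x. vector_derivative g (at x)"
  have "((\<lambda>x. prod (f x) (g x)) has_vector_derivative prod (f x) (?g' x) + prod (?f' x) (g x)) (at x)" for x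
    using Suc.prems[THEN times_differentiable_Suc_has_vector_derivative]
    by (intro has_vector_derivative)
  moreover have "times_differentiable m (\<lambda>x. prod (f x) (?g' x) + prod (?f' x) (g x))"
    using Suc.prems Suc.IH times_differentiable_lower[OF Suc.prems(1)]
      times_differentiable_lower[OF Suc.prems(2)]
    by (intro times_differentiable_add) auto
  ultimately show ?case
    by (rule times_differentiable_Suc_iff[THEN iffD2])
qed simp

text \<open>The derivative of a power contains a power with another exponent, so the induction is over all
  \<open>p\<close> simultaneously. Positivity of \<open>f\<close> keeps every exponent harmless, and roots and reciprocals
  need no separate treatment.\<close>
lemma times_differentiable_powr:
  fixes f :: "real \<Rightarrow> real"
  assumes "times_differentiable m f" "\<And>x. f x > 0"
  shows "times_differentiable m (\<lambda>x. f x powr p)"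
  using assms(1)
proof (induction m arbitrary: p)
  case (Suc m)
  let ?f' = "\<lambda>x. vector_derivative f (at x)"
  have "((\<lambda>x. f x powr p) has_vector_derivative ?f' x * (p * f x powr (p - 1))) (at x)" for x
  proof -
    have "(f has_real_derivative ?f' x) (at x)"
      using times_differentiable_Suc_has_vector_derivative[OF Suc.prems]
      by (simp add: has_real_derivative_iff_has_vector_derivative)
    from DERIV_chain2[OF has_real_derivative_powr[OF assms(2)] this, of p]
    show ?thesis
      by (simp add: has_real_derivative_iff_has_vector_derivative mult_ac)
  qed
  moreover have "times_differentiable m (\<lambda>x. ?f' x * (p * f x powr (p - 1)))"
    using Suc.prems Suc.IH times_differentiable_lower[OF Suc.prems]
    by (intro bounded_bilinear.times_differentiable[OF bounded_bilinear_mult]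
        times_differentiable_const) auto
  ultimately show ?case
    by (rule times_differentiable_Suc_iff[THEN iffD2])
qed simp

lemma smooth_const: "smooth (\<lambda>x. k)"
  by (simp add: smooth_iff_times_differentiable times_differentiable_const)

lemma smooth_add: "smooth f \<Longrightarrow> smooth g \<Longrightarrow> smooth (\<lambda>x. f x + g x)"
  by (simp add: smooth_iff_times_differentiable times_differentiable_add)

lemma (in bounded_bilinear) smooth: "smooth f \<Longrightarrow> smooth g \<Longrightarrow> smooth (\<lambda>x. prod (f x) (g x))"
  by (simp add: smooth_iff_times_differentiable times_differentiable)

lemmas smooth_inner = bounded_bilinear.smooth[OF bounded_bilinear_inner]

lemma smooth_has_vector_derivative:
  "smooth f \<Longrightarrow> (f has_vector_derivative vector_derivative f (at x)) (at x)"
  unfolding smooth_iff_times_differentiable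
  using times_differentiable_Suc_has_vector_derivative by blast

lemma smooth_iff_smooth_derivative:
  assumes "\<And>x. (f has_vector_derivative f' x) (at x)"
  shows "smooth f \<longleftrightarrow> smooth f'"
  unfolding smooth_iff_times_differentiable
  using times_differentiable_Suc_iff[OF assms] times_differentiable_lower by blast

lemma smooth_vector_derivative: "smooth f \<Longrightarrow> smooth (\<lambda>t. vector_derivative f (at t))"
  using smooth_iff_smooth_derivative[OF smooth_has_vector_derivative] by blast

lemma smooth_continuous_at: "smooth f \<Longrightarrow> isCont f x"
  using smooth_has_vector_derivative has_vector_derivative_continuous by blast

text \<open>The norm is not smooth at the origin; away from it, it is a power of the smooth positive
  function \<open>f \<bullet> f\<close>.\<close>
lemma smooth_norm_powr:
  fixes f :: "real \<Rightarrow> 'a::real_inner"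
  assumes "smooth f" "\<And>x. f x \<noteq> 0"
  shows "smooth (\<lambda>x. norm (f x) powr p)"
proof -
  have "smooth (\<lambda>x. (f x \<bullet> f x) powr (p / 2))"
    using smooth_inner[OF assms(1) assms(1)] times_differentiable_powr[of _ "\<lambda>x. f x \<bullet> f x"] assms(2)
    by (simp add: smooth_iff_times_differentiable)
  moreover have "(f x \<bullet> f x) powr (p / 2) = norm (f x) powr p" for x
    using assms(2)[of x]
    by (simp add: norm_eq_sqrt_inner powr_half_sqrt[symmetric] powr_powr)
  ultimately show ?thesis by simp
qed

section \<open>Smooth functions on the circle\<close>

lemma smooth_S1_const: "(\<lambda>x. k) \<in> smooth_S1"
  by (simp add: smooth_S1_def smooth_const)

lemma smooth_S1_add: "f \<in> smooth_S1 \<Longrightarrow> g \<in> smooth_S1 \<Longrightarrow> (\<lambda>x. f x + g x) \<in> smooth_S1"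
  by (simp add: smooth_S1_def smooth_add)

lemma (in bounded_bilinear) smooth_S1:
  "f \<in> smooth_S1 \<Longrightarrow> g \<in> smooth_S1 \<Longrightarrow> (\<lambda>x. prod (f x) (g x)) \<in> smooth_S1"
  by (simp add: smooth_S1_def smooth)

lemmas smooth_S1_scaleR = bounded_bilinear.smooth_S1[OF bounded_bilinear_scaleR]
lemmas smooth_S1_mult = bounded_bilinear.smooth_S1[OF bounded_bilinear_mult]
lemmas smooth_S1_inner = bounded_bilinear.smooth_S1[OF bounded_bilinear_inner]

lemma smooth_S1_diff: "f \<in> smooth_S1 \<Longrightarrow> g \<in> smooth_S1 \<Longrightarrow> (\<lambda>x. f x - g x) \<in> smooth_S1"
  using smooth_S1_add[of f "\<lambda>x. -1 *\<^sub>R g x"] smooth_S1_scaleR[OF smooth_S1_const, of g "-1"] by simp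

lemma subspace_smooth_S1: "subspace (smooth_S1 :: (real \<Rightarrow> 'a::real_normed_vector) set)"
  unfolding subspace_def
  by (auto simp: zero_fun_def plus_fun_def scaleR_fun_def
      intro!: smooth_S1_const smooth_S1_add smooth_S1_scaleR)

lemma smooth_S1_vector_derivative:
  assumes "f \<in> smooth_S1"
  shows "(\<lambda>t. vector_derivative f (at t)) \<in> smooth_S1"
proof -
  have f: "smooth f" and per: "f (t + 2 * pi) = f t" for t
    using assms by (auto simp: smooth_S1_def)
  have "vector_derivative f (at (t + 2 * pi)) = vector_derivative f (at t)" for t
  proof -
    have "((\<lambda>s. s + 2 * pi) has_vector_derivative 1) (at t)"
      by (auto intro!: derivative_eq_intros)
    from vector_diff_chain_at[OF this smooth_has_vector_derivative[OF f]]
    have "(f has_vector_derivative vector_derivative f (at (t + 2 * pi))) (at t)"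
      by (simp add: o_def per)
    then show ?thesis
      by (simp add: vector_derivative_at)
  qed
  then show ?thesis
    using smooth_vector_derivative[OF f] by (simp add: smooth_S1_def)
qed

lemma constant_if_zero_derivative:
  fixes f :: "real \<Rightarrow> real"
  assumes "\<And>x. (f has_vector_derivative 0) (at x)"
  shows "f x = f y"
  using assms DERIV_isconst_all[of f x y]
  by (simp add: has_real_derivative_iff_has_vector_derivative)

text \<open>A primitive of a periodic function changes by the same amount over every period, because
  \<open>b (t + 2 * pi) - b t\<close> has derivative zero; hence closing up over one period suffices for
  periodicity.\<close>
lemma smooth_S1_primitive:
  fixes b g :: "real \<Rightarrow> real"
  assumes g: "g \<in> smooth_S1" and b: "\<And>x. (b has_vector_derivative g x) (at x)"
    and closed: "b (2 * pi) = b 0"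
  shows "b \<in> smooth_S1"
proof -
  have "((\<lambda>s. b (s + 2 * pi) - b s) has_vector_derivative 0) (at t)" for t
  proof -
    have "((\<lambda>s. s + 2 * pi) has_vector_derivative 1) (at t)"
      by (auto intro!: derivative_eq_intros)
    from vector_diff_chain_at[OF this b] have
      "((\<lambda>s. b (s + 2 * pi)) has_vector_derivative g t) (at t)"
      using g by (simp add: o_def smooth_S1_def)
    from has_vector_derivative_diff[OF this b[of t]] show ?thesis by simp
  qed
  from constant_if_zero_derivative[OF this, of _ 0] closed
  have "b (t + 2 * pi) = b t" for t by simp
  moreover have "smooth b"
    using g smooth_iff_smooth_derivative[OF b] by (simp add: smooth_S1_def)
  ultimately show ?thesis by (simp add: smooth_S1_def)
qed

lemma smooth_primitive_exists:
  fixes g :: "real \<Rightarrow> real"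
  assumes "smooth g"
  shows "\<exists>G. \<forall>x. (G has_vector_derivative g x) (at x)"
  using einterval_antiderivative[of "-\<infinity>" "\<infinity>" g] smooth_continuous_at[OF assms] by simp

section \<open>The moving frame of a regular curve\<close>

abbreviation speed :: "(real \<Rightarrow> complex) \<Rightarrow> real \<Rightarrow> real" where
  "speed c \<theta> \<equiv> norm (vector_derivative c (at \<theta>))"

lemma speed_pos: "c \<in> Imm \<Longrightarrow> speed c \<theta> > 0"
  by (simp add: Imm_def)

lemma smooth_S1_speed_powr:
  assumes "c \<in> Imm"
  shows "(\<lambda>\<theta>. speed c \<theta> powr p) \<in> smooth_S1"
proof -
  have "(\<lambda>t. vector_derivative c (at t)) \<in> smooth_S1"
    using assms smooth_S1_vector_derivative by (auto simp: Imm_def)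
  then show ?thesis
    using smooth_norm_powr[of "\<lambda>t. vector_derivative c (at t)"] assms
    by (simp add: smooth_S1_def Imm_def)
qed

lemma smooth_S1_speed: "c \<in> Imm \<Longrightarrow> speed c \<in> smooth_S1"
  using smooth_S1_speed_powr[of c 1] by simp

lemma smooth_S1_inverse_speed: "c \<in> Imm \<Longrightarrow> (\<lambda>\<theta>. 1 / speed c \<theta>) \<in> smooth_S1"
  using smooth_S1_speed_powr[of c "-1"] by (simp add: powr_minus_divide)

lemma smooth_S1_D_s: "c \<in> Imm \<Longrightarrow> f \<in> smooth_S1 \<Longrightarrow> D_s c f \<in> smooth_S1"
  unfolding D_s_def
  by (intro smooth_S1_scaleR smooth_S1_inverse_speed smooth_S1_vector_derivative)

text \<open>The frame inherits smoothness from that of \<open>D_s\<close>.\<close>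
lemma unit_tangent_eq_D_s: "unit_tangent c = D_s c c"
  by (simp add: unit_tangent_def D_s_def inverse_eq_divide)

lemma smooth_S1_unit_tangent: "c \<in> Imm \<Longrightarrow> unit_tangent c \<in> smooth_S1"
  unfolding unit_tangent_eq_D_s by (rule smooth_S1_D_s) (auto simp: Imm_def)

lemma smooth_S1_unit_normal: "c \<in> Imm \<Longrightarrow> unit_normal c \<in> smooth_S1"
  unfolding unit_normal_def by (intro smooth_S1_mult smooth_S1_const smooth_S1_unit_tangent)

lemma norm_unit_tangent: "c \<in> Imm \<Longrightarrow> norm (unit_tangent c \<theta>) = 1"
  by (simp add: unit_tangent_def Imm_def)

lemma norm_unit_normal: "c \<in> Imm \<Longrightarrow> norm (unit_normal c \<theta>) = 1"
  by (simp add: unit_normal_def norm_unit_tangent norm_mult)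

lemma inner_normal_tangent: "unit_normal c \<theta> \<bullet> unit_tangent c \<theta> = 0"
  by (simp add: unit_normal_def inner_complex_def)

lemma inner_normal_frame_combination:
  assumes "c \<in> Imm"
  shows "(a *\<^sub>R unit_normal c \<theta> + b *\<^sub>R unit_tangent c \<theta>) \<bullet> unit_normal c \<theta> = a"
  using norm_unit_normal[OF assms, of \<theta>] inner_normal_tangent[of c \<theta>]
    inner_commute[of "unit_tangent c \<theta>" "unit_normal c \<theta>"]
  by (simp add: inner_left_distrib norm_eq_1)

text \<open>In coordinates this is \<open>x\<^sup>2 + y\<^sup>2 = 1\<close> for \<open>v = x + i y\<close> and \<open>n = - y + i x\<close>.\<close>
lemma frame_expansion:
  assumes "c \<in> Imm"
  shows "z = (z \<bullet> unit_normal c \<theta>) *\<^sub>R unit_normal c \<theta> + (z \<bullet> unit_tangent c \<theta>) *\<^sub>R unit_tangent c \<theta>"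
proof -
  define x y where "x = Re (unit_tangent c \<theta>)" and "y = Im (unit_tangent c \<theta>)"
  have one: "x * x + y * y = 1"
    using norm_unit_tangent[OF assms, of \<theta>] by (simp add: norm_eq_1 inner_complex_def x_def y_def)
  have "Re z = Re z * (x * x + y * y)" "Im z = Im z * (x * x + y * y)"
    using one by auto
  then show ?thesis
    unfolding complex_eq_iff unit_normal_def inner_complex_def
    by (simp add: x_def[symmetric] y_def[symmetric] algebra_simps)
qed

text \<open>The curvature is defined by a description operator; this explicit formula shows that it is
  smooth. Differentiating \<open>\<langle>v, v\<rangle> = 1\<close> gives \<open>\<langle>D\<^sub>s v, v\<rangle> = 0\<close>, so \<open>D\<^sub>s v\<close> is its own normal
  component.\<close>
lemma curvature_eq_inner:
  assumes "c \<in> Imm"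
  shows "curvature c \<theta> = D_s c (unit_tangent c) \<theta> \<bullet> unit_normal c \<theta>"
proof -
  let ?v = "unit_tangent c"
  let ?v' = "vector_derivative ?v (at \<theta>)"
  have "(?v has_vector_derivative ?v') (at \<theta>)"
    using smooth_S1_unit_tangent[OF assms] smooth_has_vector_derivative by (auto simp: smooth_S1_def)
  from bounded_bilinear.has_vector_derivative[OF bounded_bilinear_inner this this]
  have "((\<lambda>t. ?v t \<bullet> ?v t) has_vector_derivative 2 * (?v' \<bullet> ?v \<theta>)) (at \<theta>)"
    by (simp add: inner_commute)
  moreover have "(\<lambda>t. ?v t \<bullet> ?v t) = (\<lambda>t. 1)"
    using norm_unit_tangent[OF assms] by (simp add: norm_eq_1)
  ultimately have "((\<lambda>t. 1) has_vector_derivative 2 * (?v' \<bullet> ?v \<theta>)) (at \<theta>)"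
    by (simp only:)
  from vector_derivative_at[OF this] have "?v' \<bullet> ?v \<theta> = 0"
    by simp
  then have perp: "D_s c ?v \<theta> \<bullet> ?v \<theta> = 0"
    by (simp add: D_s_def)
  show ?thesis
    unfolding curvature_def
  proof (rule the_equality)
    show "D_s c ?v \<theta> = (D_s c ?v \<theta> \<bullet> unit_normal c \<theta>) *\<^sub>R unit_normal c \<theta>"
      using frame_expansion[OF assms, of "D_s c ?v \<theta>" \<theta>] perp by simp
  next
    fix k assume "D_s c ?v \<theta> = k *\<^sub>R unit_normal c \<theta>"
    then show "k = D_s c ?v \<theta> \<bullet> unit_normal c \<theta>"
      using norm_unit_normal[OF assms, of \<theta>] by (simp add: norm_eq_1)
  qed
qed

lemma smooth_S1_curvature:
  assumes c: "c \<in> Imm"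
  shows "curvature c \<in> smooth_S1"
proof -
  have "curvature c = (\<lambda>\<theta>. D_s c (unit_tangent c) \<theta> \<bullet> unit_normal c \<theta>)"
    using curvature_eq_inner[OF c] by blast
  then show ?thesis
    using smooth_S1_inner[OF smooth_S1_D_s[OF c smooth_S1_unit_tangent[OF c]] smooth_S1_unit_normal[OF c]]
    by simp
qed

section \<open>The arc length equation\<close>

lemma has_vector_derivative_D_s:
  assumes "c \<in> Imm" "f \<in> smooth_S1"
  shows "(f has_vector_derivative speed c \<theta> *\<^sub>R D_s c f \<theta>) (at \<theta>)"
  using assms smooth_has_vector_derivative speed_pos[OF assms(1), of \<theta>]
  by (auto simp: D_s_def smooth_S1_def)

lemma D_s_eqI:
  assumes "c \<in> Imm" "(f has_vector_derivative speed c \<theta> *\<^sub>R y) (at \<theta>)"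
  shows "D_s c f \<theta> = y"
  using vector_derivative_at[OF assms(2)] speed_pos[OF assms(1), of \<theta>] by (simp add: D_s_def)

text \<open>Since the curve is regular, \<open>D_s\<close> and the ordinary derivative annihilate the same functions,
  namely the constants; so the second order equation fixes \<open>D_s c b\<close> up to a constant. In this form
  the equation can be solved, and its linearity follows from that of the derivative.\<close>
lemma arc_equation_iff_first_integral:
  fixes a b :: "real \<Rightarrow> real"
  assumes c: "c \<in> Imm" and a: "a \<in> smooth_S1" and b: "b \<in> smooth_S1"
  shows "arc_equation c a b \<longleftrightarrow> b 0 = 0 \<and>
    (\<exists>C. \<forall>\<theta>. (b has_vector_derivative speed c \<theta> * (a \<theta> * curvature c \<theta> + C)) (at \<theta>))"
    (is "_ \<longleftrightarrow> _ \<and> ?first_integral")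
proof -
  let ?g = "\<lambda>\<theta>. a \<theta> * curvature c \<theta>"
  have g: "?g \<in> smooth_S1"
    by (intro smooth_S1_mult a smooth_S1_curvature c)
  have "D_s c (D_s c b) = D_s c ?g \<longleftrightarrow> ?first_integral"
  proof
    assume eq: "D_s c (D_s c b) = D_s c ?g"
    have "((\<lambda>\<theta>. D_s c b \<theta> - ?g \<theta>) has_vector_derivative 0) (at \<theta>)" for \<theta>
      using has_vector_derivative_diff[OF has_vector_derivative_D_s[OF c smooth_S1_D_s[OF c b]]
          has_vector_derivative_D_s[OF c g], of \<theta>] eq by simp
    from constant_if_zero_derivative[OF this, of _ 0]
    have "D_s c b \<theta> = ?g \<theta> + (D_s c b 0 - ?g 0)" for \<theta>
      by (simp add: algebra_simps)
    then show ?first_integral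
      using has_vector_derivative_D_s[OF c b] by (metis real_scaleR_def)
  next
    assume ?first_integral
    then obtain C where "\<And>\<theta>. (b has_vector_derivative speed c \<theta> * (?g \<theta> + C)) (at \<theta>)" by blast
    then have "D_s c b = (\<lambda>\<theta>. ?g \<theta> + C)"
      using D_s_eqI[OF c] by (metis (no_types, lifting) ext real_scaleR_def)
    moreover have "D_s c (\<lambda>\<theta>. ?g \<theta> + C) \<theta> = D_s c ?g \<theta>" for \<theta>
      using has_vector_derivative_add[OF has_vector_derivative_D_s[OF c g, of \<theta>]
          has_vector_derivative_const[of C]]
      by (intro D_s_eqI[OF c]) simp
    ultimately show "D_s c (D_s c b) = D_s c ?g" by auto
  qed
  then show ?thesis by (auto simp: arc_equation_def)
qed

lemma arc_equation_add:
  assumes c: "c \<in> Imm"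
    and a: "a \<in> smooth_S1" "a' \<in> smooth_S1" and b: "b \<in> smooth_S1" "b' \<in> smooth_S1"
    and eq: "arc_equation c a b" "arc_equation c a' b'"
  shows "arc_equation c (\<lambda>\<theta>. a \<theta> + a' \<theta>) (\<lambda>\<theta>. b \<theta> + b' \<theta>)"
proof -
  obtain C C' where
    "\<And>\<theta>. (b has_vector_derivative speed c \<theta> * (a \<theta> * curvature c \<theta> + C)) (at \<theta>)"
    "\<And>\<theta>. (b' has_vector_derivative speed c \<theta> * (a' \<theta> * curvature c \<theta> + C')) (at \<theta>)"
    using eq arc_equation_iff_first_integral[OF c a(1) b(1)]
      arc_equation_iff_first_integral[OF c a(2) b(2)] by blast
  from has_vector_derivative_add[OF this]
  have "((\<lambda>\<theta>. b \<theta> + b' \<theta>) has_vector_derivative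
      speed c \<theta> * ((a \<theta> + a' \<theta>) * curvature c \<theta> + (C + C'))) (at \<theta>)" for \<theta>
    by (simp add: algebra_simps)
  then show ?thesis
    using eq arc_equation_iff_first_integral[OF c smooth_S1_add[OF a] smooth_S1_add[OF b]]
    by (auto simp: arc_equation_def)
qed

lemma arc_equation_scale:
  assumes c: "c \<in> Imm" and a: "a \<in> smooth_S1" and b: "b \<in> smooth_S1"
    and eq: "arc_equation c a b"
  shows "arc_equation c (\<lambda>\<theta>. r * a \<theta>) (\<lambda>\<theta>. r * b \<theta>)"
proof -
  obtain C where
    "\<And>\<theta>. (b has_vector_derivative speed c \<theta> * (a \<theta> * curvature c \<theta> + C)) (at \<theta>)"
    using eq arc_equation_iff_first_integral[OF c a b] by blast
  from has_vector_derivative_mult_right[OF this, of r]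
  have "((\<lambda>\<theta>. r * b \<theta>) has_vector_derivative
      speed c \<theta> * ((r * a \<theta>) * curvature c \<theta> + r * C)) (at \<theta>)" for \<theta>
    by (simp add: algebra_simps)
  then show ?thesis
    using eq arc_equation_iff_first_integral[OF c smooth_S1_mult[OF smooth_S1_const a]
        smooth_S1_mult[OF smooth_S1_const b], of r r]
    by (auto simp: arc_equation_def)
qed

lemma arc_equation_zero:
  assumes c: "c \<in> Imm"
  shows "arc_equation c (\<lambda>\<theta>. 0) (\<lambda>\<theta>. 0)"
  by (subst arc_equation_iff_first_integral[OF c smooth_S1_const smooth_S1_const])
    (auto intro!: exI[of _ 0])

text \<open>Without normal component \<open>b' = C \<bar>c'\<bar>\<close> never changes sign, but a periodic function has
  a critical point; this forces \<open>C = 0\<close>.\<close>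
lemma arc_equation_homogeneous_unique:
  assumes c: "c \<in> Imm" and b: "b \<in> smooth_S1" and eq: "arc_equation c (\<lambda>\<theta>. 0) b"
  shows "b = (\<lambda>\<theta>. 0)"
proof -
  obtain C where b': "\<And>\<theta>. (b has_vector_derivative speed c \<theta> * C) (at \<theta>)" and "b 0 = 0"
    using eq arc_equation_iff_first_integral[OF c smooth_S1_const b] by auto
  have "b (2 * pi) = b 0"
    using b unfolding smooth_S1_def by (metis (mono_tags, lifting) add_0 mem_Collect_eq)
  moreover obtain \<xi> where "b (2 * pi) - b 0 = (2 * pi - 0) * (speed c \<xi> * C)"
    using MVT2[of 0 "2 * pi" b "\<lambda>\<theta>. speed c \<theta> * C"] b'
    by (auto simp: has_real_derivative_iff_has_vector_derivative)
  ultimately have "C = 0"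
    using speed_pos[OF c, of \<xi>] by auto
  then show ?thesis
    using constant_if_zero_derivative[of b _ 0] b' \<open>b 0 = 0\<close> by auto
qed

lemma arc_equation_unique:
  assumes c: "c \<in> Imm" and a: "a \<in> smooth_S1"
    and b: "b \<in> smooth_S1" "arc_equation c a b" and b': "b' \<in> smooth_S1" "arc_equation c a b'"
  shows "b = b'"
proof -
  have "arc_equation c (\<lambda>\<theta>. a \<theta> + (-1) * a \<theta>) (\<lambda>\<theta>. b \<theta> + (-1) * b' \<theta>)"
    using a b b'
    by (intro arc_equation_add arc_equation_scale c smooth_S1_mult smooth_S1_const)
  then have "(\<lambda>\<theta>. b \<theta> - b' \<theta>) = (\<lambda>\<theta>. 0)"
    using smooth_S1_diff[OF b(1) b'(1)]
    by (intro arc_equation_homogeneous_unique[OF c]) simp_all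
  then show ?thesis by (metis eq_iff_diff_eq_0 ext)
qed

text \<open>A primitive \<open>G\<close> of \<open>\<bar>c'\<bar> a \<kappa>\<close> need not be periodic, but neither is the arc length
  function \<open>s\<close>, which grows by the positive length of the curve over a period. A multiple of \<open>s\<close>
  therefore corrects the defect of \<open>G\<close>, and it adds only a constant to \<open>D\<^sub>s b\<close>.\<close>
lemma arc_equation_exists:
  assumes c: "c \<in> Imm" and a: "a \<in> smooth_S1"
  shows "\<exists>b. b \<in> smooth_S1 \<and> arc_equation c a b"
proof -
  let ?g = "\<lambda>\<theta>. speed c \<theta> * (a \<theta> * curvature c \<theta>)"
  have "?g \<in> smooth_S1"
    by (intro smooth_S1_mult smooth_S1_speed smooth_S1_curvature a c)
  then obtain G where G: "\<And>\<theta>. (G has_vector_derivative ?g \<theta>) (at \<theta>)"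
    using smooth_primitive_exists[of ?g] by (auto simp: smooth_S1_def)
  obtain s where s: "\<And>\<theta>. (s has_vector_derivative speed c \<theta>) (at \<theta>)"
    using smooth_primitive_exists[of "speed c"] smooth_S1_speed[OF c] by (auto simp: smooth_S1_def)
  have "s 0 < s (2 * pi)"
  proof (rule DERIV_pos_imp_increasing[of 0 "2 * pi" s])
    fix \<theta>
    show "\<exists>y. (s has_real_derivative y) (at \<theta>) \<and> y > 0"
      using s[of \<theta>] speed_pos[OF c, of \<theta>]
      unfolding has_real_derivative_iff_has_vector_derivative by blast
  qed simp
  \<comment> \<open>minus the mean of \<open>a \<kappa>\<close> with respect to arc length: the only choice that closes \<open>b\<close> up\<close>
  define C where "C = - (G (2 * pi) - G 0) / (s (2 * pi) - s 0)"
  define b where "b = (\<lambda>\<theta>. (G \<theta> - G 0) + C * (s \<theta> - s 0))"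
  have b': "(b has_vector_derivative speed c \<theta> * (a \<theta> * curvature c \<theta> + C)) (at \<theta>)" for \<theta>
  proof -
    have "(b has_vector_derivative (?g \<theta> - 0) + C * (speed c \<theta> - 0)) (at \<theta>)"
      unfolding b_def
      by (intro has_vector_derivative_add has_vector_derivative_diff has_vector_derivative_mult_right
          has_vector_derivative_const G s)
    then show ?thesis by (simp add: algebra_simps)
  qed
  have "b \<in> smooth_S1"
  proof (rule smooth_S1_primitive[OF _ b'])
    show "(\<lambda>\<theta>. speed c \<theta> * (a \<theta> * curvature c \<theta> + C)) \<in> smooth_S1"
      by (intro smooth_S1_mult smooth_S1_add smooth_S1_speed smooth_S1_curvature smooth_S1_const a c)
    show "b (2 * pi) = b 0"
      using \<open>s 0 < s (2 * pi)\<close> by (simp add: b_def C_def)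
  qed
  moreover have "b 0 = 0" by (simp add: b_def)
  ultimately have "arc_equation c a b"
    using b' arc_equation_iff_first_integral[OF c a \<open>b \<in> smooth_S1\<close>] by auto
  with \<open>b \<in> smooth_S1\<close> show ?thesis by blast
qed

section \<open>The decomposition\<close>

lemma direct_sum_decomp_commute:
  assumes "direct_sum_decomp W U V"
  shows "direct_sum_decomp W V U"
proof -
  have "{u + w | u w. u \<in> U \<and> w \<in> V} = {u + w | u w. u \<in> V \<and> w \<in> U}"
    by (metis (no_types, opaque_lifting) add.commute)
  then show ?thesis
    using assms unfolding direct_sum_decomp_def by auto
qed

lemma proj_along_direct_sum:
  assumes "direct_sum_decomp W U V" "u \<in> U" "w \<in> V"
  shows "proj_along U V (u + w) = u"
  unfolding proj_along_def
proof (rule the_equality)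
  show "u \<in> U \<and> (\<exists>w'\<in>V. u + w = u + w')"
    using assms by blast
next
  have sub: "subspace U" "subspace V" and int: "U \<inter> V = {0}"
    using assms by (auto simp: direct_sum_decomp_def)
  fix u' assume "u' \<in> U \<and> (\<exists>w'\<in>V. u + w = u' + w')"
  then obtain w' where "u' \<in> U" "w' \<in> V" "u' - u = w - w'"
    by (auto simp: algebra_simps)
  then have "u' - u \<in> U \<inter> V"
    using sub assms subspace_diff by (metis IntI)
  then show "u' = u" using int by simp
qed

lemma subspace_Tan:
  assumes c: "c \<in> Imm"
  shows "subspace (Tan c)"
  unfolding subspace_def
proof (intro conjI ballI allI)
  show "0 \<in> Tan c"
    unfolding Tan_def using smooth_S1_const[of "0::real"] by (force simp: fun_eq_iff)
next
  fix h k assume "h \<in> Tan c" "k \<in> Tan c"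
  then obtain f g where "h = (\<lambda>\<theta>. f \<theta> *\<^sub>R unit_tangent c \<theta>)" "k = (\<lambda>\<theta>. g \<theta> *\<^sub>R unit_tangent c \<theta>)"
    "f \<in> smooth_S1" "g \<in> smooth_S1" by (auto simp: Tan_def)
  then show "h + k \<in> Tan c"
    unfolding Tan_def
    by (auto simp: plus_fun_def algebra_simps intro!: exI[of _ "\<lambda>\<theta>. f \<theta> + g \<theta>"] smooth_S1_add)
next
  fix r h assume "h \<in> Tan c"
  then obtain f where "h = (\<lambda>\<theta>. f \<theta> *\<^sub>R unit_tangent c \<theta>)" "f \<in> smooth_S1"
    by (auto simp: Tan_def)
  then show "r *\<^sub>R h \<in> Tan c"
    unfolding Tan_def
    by (auto simp: scaleR_fun_def intro!: exI[of _ "\<lambda>\<theta>. r * f \<theta>"] smooth_S1_mult smooth_S1_const)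
qed

lemma Arc0_I:
  assumes "a \<in> smooth_S1" "b \<in> smooth_S1" "arc_equation c a b"
    "h = (\<lambda>\<theta>. a \<theta> *\<^sub>R unit_normal c \<theta> + b \<theta> *\<^sub>R unit_tangent c \<theta>)"
  shows "h \<in> Arc0 c"
  using assms unfolding Arc0_def by blast

lemma subspace_Arc0:
  assumes c: "c \<in> Imm"
  shows "subspace (Arc0 c)"
  unfolding subspace_def
proof (intro conjI ballI allI)
  show "0 \<in> Arc0 c"
    by (rule Arc0_I[OF smooth_S1_const smooth_S1_const arc_equation_zero[OF c]]) auto
next
  fix h k assume "h \<in> Arc0 c" "k \<in> Arc0 c"
  then obtain a b a' b' where
    hk: "h = (\<lambda>\<theta>. a \<theta> *\<^sub>R unit_normal c \<theta> + b \<theta> *\<^sub>R unit_tangent c \<theta>)"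
    "k = (\<lambda>\<theta>. a' \<theta> *\<^sub>R unit_normal c \<theta> + b' \<theta> *\<^sub>R unit_tangent c \<theta>)"
    and ab: "a \<in> smooth_S1" "a' \<in> smooth_S1" "b \<in> smooth_S1" "b' \<in> smooth_S1"
    "arc_equation c a b" "arc_equation c a' b'"
    unfolding Arc0_def by blast
  show "h + k \<in> Arc0 c"
    by (rule Arc0_I[OF smooth_S1_add smooth_S1_add arc_equation_add[OF c ab]])
      (use ab in \<open>auto simp: hk algebra_simps\<close>)
next
  fix r h assume "h \<in> Arc0 c"
  then obtain a b where
    h: "h = (\<lambda>\<theta>. a \<theta> *\<^sub>R unit_normal c \<theta> + b \<theta> *\<^sub>R unit_tangent c \<theta>)"
    and ab: "a \<in> smooth_S1" "b \<in> smooth_S1" "arc_equation c a b"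
    unfolding Arc0_def by blast
  show "r *\<^sub>R h \<in> Arc0 c"
    by (rule Arc0_I[OF smooth_S1_mult[OF smooth_S1_const] smooth_S1_mult[OF smooth_S1_const]
          arc_equation_scale[OF c ab, of r]])
      (use ab in \<open>auto simp: h scaleR_fun_def algebra_simps\<close>)
qed

text \<open>A field in both spaces has no normal component, so its tangential coefficient solves the
  homogeneous equation.\<close>
lemma Tan_Int_Arc0:
  assumes c: "c \<in> Imm"
  shows "Tan c \<inter> Arc0 c = {0}"
proof
  show "{0} \<subseteq> Tan c \<inter> Arc0 c"
    using subspace_Tan[OF c] subspace_Arc0[OF c] subspace_0 by blast
  show "Tan c \<inter> Arc0 c \<subseteq> {0}"
  proof
    fix h assume "h \<in> Tan c \<inter> Arc0 c"
    then obtain f a b where f: "h = (\<lambda>\<theta>. f \<theta> *\<^sub>R unit_tangent c \<theta>)"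
      and ab: "h = (\<lambda>\<theta>. a \<theta> *\<^sub>R unit_normal c \<theta> + b \<theta> *\<^sub>R unit_tangent c \<theta>)"
        "b \<in> smooth_S1" "arc_equation c a b"
      unfolding Arc0_def Tan_def by blast
    have "a \<theta> = 0" for \<theta>
    proof -
      have "a \<theta> = h \<theta> \<bullet> unit_normal c \<theta>"
        unfolding ab(1) by (rule inner_normal_frame_combination[OF c, symmetric])
      also have "\<dots> = 0"
        by (simp add: f inner_commute inner_normal_tangent)
      finally show ?thesis .
    qed
    then have "a = (\<lambda>\<theta>. 0)" by blast
    with ab show "h \<in> {0}"
      using arc_equation_homogeneous_unique[OF c ab(2)] by (auto simp: fun_eq_iff)
  qed
qed

lemma Tan_subset_T_Imm: "c \<in> Imm \<Longrightarrow> Tan c \<subseteq> T_Imm c"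
  unfolding Tan_def T_Imm_def by (auto intro: smooth_S1_scaleR smooth_S1_unit_tangent)

lemma Arc0_subset_T_Imm: "c \<in> Imm \<Longrightarrow> Arc0 c \<subseteq> T_Imm c"
  unfolding Arc0_def T_Imm_def
  by (auto intro!: smooth_S1_add smooth_S1_scaleR smooth_S1_unit_tangent smooth_S1_unit_normal)

text \<open>The candidates for the two projections: they lie in the right spaces and add up to \<open>k\<close>. With
  \<open>ex1_arc_equation\<close> this yields the decomposition, and with \<open>proj_along_direct_sum\<close> it identifies
  the projections.\<close>
lemma split_tangent_vector:
  assumes c: "c \<in> Imm" and k: "k \<in> T_Imm c"
    and b: "b \<in> smooth_S1" "arc_equation c (\<lambda>\<theta>. k \<theta> \<bullet> unit_normal c \<theta>) b"
  defines "t \<equiv> \<lambda>\<theta>. (k \<theta> \<bullet> unit_tangent c \<theta>) *\<^sub>R unit_tangent c \<theta> - b \<theta> *\<^sub>R unit_tangent c \<theta>"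
    and "h \<equiv> \<lambda>\<theta>. (k \<theta> \<bullet> unit_normal c \<theta>) *\<^sub>R unit_normal c \<theta> + b \<theta> *\<^sub>R unit_tangent c \<theta>"
  shows "t \<in> Tan c" "h \<in> Arc0 c" "k = t + h"
proof -
  have k: "k \<in> smooth_S1" using k by (simp add: T_Imm_def)
  have "(\<lambda>\<theta>. k \<theta> \<bullet> unit_tangent c \<theta> - b \<theta>) \<in> smooth_S1"
    by (intro smooth_S1_diff smooth_S1_inner smooth_S1_unit_tangent c k b)
  moreover have "t = (\<lambda>\<theta>. (k \<theta> \<bullet> unit_tangent c \<theta> - b \<theta>) *\<^sub>R unit_tangent c \<theta>)"
    by (simp add: t_def scaleR_left_diff_distrib)
  ultimately show "t \<in> Tan c" by (auto simp: Tan_def)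
  show "h \<in> Arc0 c"
    unfolding h_def
    by (rule Arc0_I[OF smooth_S1_inner[OF k smooth_S1_unit_normal[OF c]] b]) simp
  show "k = t + h"
    using frame_expansion[OF c] by (auto simp: fun_eq_iff t_def h_def algebra_simps)
qed

lemma ex1_arc_equation:
  assumes c: "c \<in> Imm" and k: "k \<in> T_Imm c"
  shows "\<exists>!b. b \<in> smooth_S1 \<and> arc_equation c (\<lambda>\<theta>. k \<theta> \<bullet> unit_normal c \<theta>) b"
proof -
  have "(\<lambda>\<theta>. k \<theta> \<bullet> unit_normal c \<theta>) \<in> smooth_S1"
    using k by (intro smooth_S1_inner smooth_S1_unit_normal c) (simp add: T_Imm_def)
  then show ?thesis
    using arc_equation_exists[OF c] arc_equation_unique[OF c] by blast
qed

lemma direct_sum_Tan_Arc0: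
  assumes c: "c \<in> Imm"
  shows "direct_sum_decomp (T_Imm c) (Tan c) (Arc0 c)"
  unfolding direct_sum_decomp_def
proof (intro conjI subspace_Tan subspace_Arc0 Tan_Int_Arc0 c subset_antisym)
  show "T_Imm c \<subseteq> {u + w | u w. u \<in> Tan c \<and> w \<in> Arc0 c}"
    using split_tangent_vector[OF c] ex1_arc_equation[OF c] by blast
  have "subspace (T_Imm c)"
    by (simp add: T_Imm_def subspace_smooth_S1)
  then show "{u + w | u w. u \<in> Tan c \<and> w \<in> Arc0 c} \<subseteq> T_Imm c"
    using Tan_subset_T_Imm[OF c] Arc0_subset_T_Imm[OF c] subspace_add by blast
qed

theorem lemma4:
  fixes c :: "real \<Rightarrow> complex"
  assumes "c \<in> Imm"
  shows "direct_sum_decomp (T_Imm c) (Tan c) (Arc0 c) \<and>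
    (\<forall>k \<in> T_Imm c.
      (\<exists>!b. b \<in> smooth_S1 \<and> arc_equation c (\<lambda>\<theta>. k \<theta> \<bullet> unit_normal c \<theta>) b) \<and>
      (\<forall>b. b \<in> smooth_S1 \<and> arc_equation c (\<lambda>\<theta>. k \<theta> \<bullet> unit_normal c \<theta>) b \<longrightarrow>
        proj_along (Arc0 c) (Tan c) k =
          (\<lambda>\<theta>. (k \<theta> \<bullet> unit_normal c \<theta>) *\<^sub>R unit_normal c \<theta> + b \<theta> *\<^sub>R unit_tangent c \<theta>) \<and>
        proj_along (Tan c) (Arc0 c) k =
          (\<lambda>\<theta>. (k \<theta> \<bullet> unit_tangent c \<theta>) *\<^sub>R unit_tangent c \<theta> - b \<theta> *\<^sub>R unit_tangent c \<theta>)))"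
proof (intro conjI ballI allI impI direct_sum_Tan_Arc0[OF assms] ex1_arc_equation[OF assms])
  note decomp = direct_sum_Tan_Arc0[OF assms]
  fix k b
  let
    ?t = "\<lambda>\<theta>. (k \<theta> \<bullet> unit_tangent c \<theta>) *\<^sub>R unit_tangent c \<theta> - b \<theta> *\<^sub>R unit_tangent c \<theta>" and
    ?h = "\<lambda>\<theta>. (k \<theta> \<bullet> unit_normal c \<theta>) *\<^sub>R unit_normal c \<theta> + b \<theta> *\<^sub>R unit_tangent c \<theta>"
  assume "k \<in> T_Imm c" "b \<in> smooth_S1 \<and> arc_equation c (\<lambda>\<theta>. k \<theta> \<bullet> unit_normal c \<theta>) b"
  then have k: "k \<in> T_Imm c" and b: "b \<in> smooth_S1" "arc_equation c (\<lambda>\<theta>. k \<theta> \<bullet> unit_normal c \<theta>) b"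
    by simp_all
  note split = split_tangent_vector[OF assms k b]
  show "proj_along (Tan c) (Arc0 c) k = ?t"
    by (subst split(3)) (rule proj_along_direct_sum[OF decomp split(1,2)])
  show "proj_along (Arc0 c) (Tan c) k = ?h"
    by (subst split(3), subst add.commute)
      (rule proj_along_direct_sum[OF direct_sum_decomp_commute[OF decomp] split(2,1)])
qed

end
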